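(* Let $n_1,n_2,n_3,n_4\in\mathbb C\setminus\{0\}$ and $\alpha_0,\dots,\alpha_4\in\mathbb C$. Suppose that a system of the form $(S)$ (see context), with coefficients $a_1,\dots,a_{10}\in\mathbb C(t)$, has the Painlevé scheme $$\begin{pmatrix} X=0 & X=1 & X=t & X=\infty\\ f_0\begin{pmatrix}n_1&\alpha_4\\0&1\end{pmatrix} & f_1\begin{pmatrix}n_2&\alpha_3\\0&1\end{pmatrix} & f_2\begin{pmatrix}n_3&\alpha_0\\0&1\end{pmatrix} & f_3\begin{pmatrix}n_4&\alpha_1\\0&1\end{pmatrix}\end{pmatrix}$$ for some $f_0,f_1,f_2,f_3\in\mathbb C(t)$; that is, $X=0,1,t,\infty$ are accessible singular points and the matrix of linear approximation at each of them is the one listed below it. Put $\kappa:=2n_1n_2n_3-n_1n_2-n_1n_3-n_2n_3$ and $\delta:=n_1n_2\alpha_0+\kappa\alpha_1-n_1n_2n_3\alpha_2+n_1n_3\alpha_3+n_2n_3\alpha_4$. Then the system coincides with $$\begin{aligned}\delta t(t-1)\frac{dx}{dt}=&\,n_1n_2n_3\,x(x-1)(t-x)y+\{\kappa\alpha_1-n_1n_2n_3\alpha_2\}x^2\\&+\{-\kappa\alpha_1+n_1n_2n_3\alpha_2+n_1n_3\alpha_3(t-1)+n_2n_3\alpha_4t\}x-n_2n_3\alpha_4t,\\ \delta t(t-1)\frac{dy}{dt}=&\,[(n_1n_2+n_2n_3+n_1n_3)x^2-\{n_1n_2+n_2n_3+(n_1+n_2)n_3t\}x+n_2n_3t]y^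2\\&+[-\{2\kappa\alpha_1+(n_1n_2n_3-2n_1n_2-2n_1n_3-2n_2n_3)\alpha_2\}x+\kappa\alpha_1\\&\quad+\{(n_1n_2-n_1-n_2)n_3t-n_1n_2-n_2n_3\}\alpha_2-n_1n_3\alpha_3(t-1)-n_2n_3\alpha_4t]y\\&-\alpha_2[\kappa\alpha_1+(n_1n_2n_3-n_1n_2-n_1n_3-n_2n_3)\alpha_2].\end{aligned}$$
   Context: System $(S)$: for a constant $\alpha_2\in\mathbb C$ and $a_i=a_i(t)\in\mathbb C(t)$, $$\frac{dx}{dt}=a_1x^3y+a_2x^2y+a_5xy+a_7y+\tfrac12\big((3a_1+2a_3)\alpha_2-a_4\big)x^2+\big((a_2+a_9)\alpha_2-a_6\big)x+a_8,$$ $$\frac{dy}{dt}=a_3x^2y^2+a_9xy^2+a_{10}y^2+a_4xy+a_6y+\tfrac12(a_1\alpha_2+a_4)\alpha_2 .$$ This system is also polynomial in the coordinates $(x_1,y_1)=(1/x,\,-(xy+\alpha_2)x)$. Local coordinates: at the point $X=c$ with $c\in\{0,1,t\}$ use $(X,Y)=(x-c,1/y)$ (for $c=t$ one has $dX/dt=dx/dt-1$); at $X=\infty$ use $(X,Y)=(x_1,1/y_1)$. In each of these coordinates the system has the form $\frac{dX}{dt}=\frac{G(X,Y)}{Y}$, $\frac{dY}{dt}=H(X,Y)$ with $G,H\in\mathbb C(t)[X,Y]$. The point $(X,Y)=(0,0)$ is an accessible singular point if $G(0,0)=0$. Its matrix of linear approximation is the matrix $M=\begin{pmatrix}M_{11}&M_{12}\\0&M_{22}\end{pmatrix}$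 over $\mathbb C(t)$ such that $\frac{d}{dt}\binom{X}{Y}=\frac1Y\left\{M\binom XY+(\text{terms of order}\ge 2\text{ in }X,Y)\right\}$, i.e. $G=M_{11}X+M_{12}Y+O(2)$ and $H(0,0)=M_{22}$. A Painlevé scheme is a list of accessible singular points together with their matrices of linear approximation. *)

theory Defs
  imports
    "HOL-Computational_Algebra.Computational_Algebra"
    "Jordan_Normal_Form.Matrix"
begin

section \<open>The fields \<open>\<complex>(t)\<close> and \<open>\<complex>(t)(x,y)\<close>\<close>

type_synonym ratfun = "complex poly fract"

text \<open>
  A bivariate polynomial over \<open>\<complex>(t)\<close> is a polynomial in the second variable whose coefficients
  are polynomials in the first variable.
\<close>

type_synonym bipoly = "ratfun poly poly"

type_synonym ratfun_xy = "bipoly fract"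

definition cst :: "complex \<Rightarrow> ratfun"
  where "cst c = to_fract [:c:]"

definition tvar :: ratfun  (\<open>\<t>\<close>)
  where "\<t> = to_fract [:0, 1:]"

definition emb :: "ratfun \<Rightarrow> ratfun_xy"
  where "emb f = to_fract [:[:f:]:]"

definition xvar :: ratfun_xy  (\<open>\<x>\<close>)
  where "\<x> = to_fract [:[:0, 1:]:]"

definition yvar :: ratfun_xy  (\<open>\<y>\<close>)
  where "\<y> = to_fract [:0, 1:]"

text \<open>\<open>bicoeff P i j\<close> is the coefficient of \<open>X\<^sup>i Y\<^sup>j\<close>, and \<open>bieval P X Y\<close> is \<open>P(X, Y)\<close>.\<close>

definition bicoeff :: "bipoly \<Rightarrow> nat \<Rightarrow> nat \<Rightarrow> ratfun"
  where "bicoeff P i j = coeff (coeff P j) i"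

definition bieval :: "bipoly \<Rightarrow> ratfun_xy \<Rightarrow> ratfun_xy \<Rightarrow> ratfun_xy"
  where "bieval P X Y = poly (map_poly (\<lambda>p. poly (map_poly emb p) X) P) Y"


section \<open>The system\<close>

text \<open>
  A non-autonomous system \<open>dx/dt = F(t,x,y), dy/dt = G(t,x,y)\<close> is represented by its total time
  derivative \<open>D = d/dt\<close>: the derivation of \<open>\<complex>(t)(x,y)\<close> that vanishes on \<open>\<complex>\<close> and satisfies
  \<open>D t = 1\<close>, \<open>D x = F\<close>, \<open>D y = G\<close>. Rewriting the system in coordinates \<open>(X,Y)\<close> then means
  expressing \<open>D X\<close> and \<open>D Y\<close> through \<open>X\<close> and \<open>Y\<close>.
\<close>

definition is_time_derivative :: "(ratfun_xy \<Rightarrow> ratfun_xy) \<Rightarrow> bool" where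
  "is_time_derivative D \<longleftrightarrow>
     (\<forall>u v. D (u + v) = D u + D v) \<and>
     (\<forall>u v. D (u * v) = D u * v + u * D v) \<and>
     (\<forall>c. D (emb (cst c)) = 0) \<and>
     D (emb \<t>) = 1"

definition S_rhs_x :: "complex \<Rightarrow> (nat \<Rightarrow> ratfun) \<Rightarrow> ratfun_xy" where
  "S_rhs_x \<alpha>2 a =
     emb (a 1) * \<x> ^ 3 * \<y> + emb (a 2) * \<x> ^ 2 * \<y> + emb (a 5) * \<x> * \<y> + emb (a 7) * \<y>
     + emb (1/2 * ((3 * a 1 + 2 * a 3) * cst \<alpha>2 - a 4)) * \<x> ^ 2
     + emb ((a 2 + a 9) * cst \<alpha>2 - a 6) * \<x>
     + emb (a 8)"

definition S_rhs_y :: "complex \<Rightarrow> (nat \<Rightarrow> ratfun) \<Rightarrow> ratfun_xy" where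
  "S_rhs_y \<alpha>2 a =
     emb (a 3) * \<x> ^ 2 * \<y> ^ 2 + emb (a 9) * \<x> * \<y> ^ 2 + emb (a 10) * \<y> ^ 2
     + emb (a 4) * \<x> * \<y> + emb (a 6) * \<y>
     + emb (1/2 * (a 1 * cst \<alpha>2 + a 4) * cst \<alpha>2)"

definition is_system_S ::
    "complex \<Rightarrow> (nat \<Rightarrow> ratfun) \<Rightarrow> (ratfun_xy \<Rightarrow> ratfun_xy) \<Rightarrow> bool" where
  "is_system_S \<alpha>2 a D \<longleftrightarrow>
     is_time_derivative D \<and> D \<x> = S_rhs_x \<alpha>2 a \<and> D \<y> = S_rhs_y \<alpha>2 a"


section \<open>Local coordinates, accessible singular points, linear approximation\<close>

definition finite_coords :: "ratfun \<Rightarrow> ratfun_xy \<times> ratfun_xy" where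
  "finite_coords c = (\<x> - emb c, 1 / \<y>)"

definition infinity_coords :: "complex \<Rightarrow> ratfun_xy \<times> ratfun_xy" where
  "infinity_coords \<alpha>2 =
     (let x1 = 1 / \<x>; y1 = - (\<x> * \<y> + emb (cst \<alpha>2)) * \<x> in (x1, 1 / y1))"

definition has_local_form ::
    "(ratfun_xy \<Rightarrow> ratfun_xy) \<Rightarrow> ratfun_xy \<times> ratfun_xy \<Rightarrow> bipoly \<Rightarrow> bipoly \<Rightarrow> bool" where
  "has_local_form D XY G H \<longleftrightarrow>
     (case XY of (X, Y) \<Rightarrow> D X = bieval G X Y / Y \<and> D Y = bieval H X Y)"

text \<open>
  In all coordinate pairs used here \<open>X\<close> and \<open>Y\<close> are algebraically independent over \<open>\<complex>(t)\<close>, so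
  that \<open>G\<close> and \<open>H\<close> are uniquely determined.
\<close>

definition accessible_singular_point ::
    "(ratfun_xy \<Rightarrow> ratfun_xy) \<Rightarrow> ratfun_xy \<times> ratfun_xy \<Rightarrow> bool" where
  "accessible_singular_point D XY \<longleftrightarrow>
     (\<exists>G H. has_local_form D XY G H \<and> bicoeff G 0 0 = 0)"

definition linear_approximation ::
    "(ratfun_xy \<Rightarrow> ratfun_xy) \<Rightarrow> ratfun_xy \<times> ratfun_xy \<Rightarrow> ratfun mat \<Rightarrow> bool" where
  "linear_approximation D XY M \<longleftrightarrow>
     (\<exists>G H. has_local_form D XY G H \<and> bicoeff G 0 0 = 0 \<and>
        M = mat_of_rows_list 2 [[bicoeff G 1 0, bicoeff G 0 1],
                                [0,             bicoeff H 0 0]])"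

definition has_painleve_scheme ::
    "(ratfun_xy \<Rightarrow> ratfun_xy) \<Rightarrow> ((ratfun_xy \<times> ratfun_xy) \<times> ratfun mat) list \<Rightarrow> bool" where
  "has_painleve_scheme D S \<longleftrightarrow>
     (\<forall>(XY, M) \<in> set S. accessible_singular_point D XY \<and> linear_approximation D XY M)"

definition scheme_matrix :: "ratfun \<Rightarrow> complex \<Rightarrow> complex \<Rightarrow> ratfun mat" where
  "scheme_matrix f n \<alpha> = f \<cdot>\<^sub>m mat_of_rows_list 2 [[cst n, cst \<alpha>], [0, 1]]"


section \<open>Existence of the total time derivative\<close>

text \<open>
  For all right-hand sides there is a time derivative, so \<^const>\<open>is_system_S\<close> is satisfiable for
  every choice of coefficients. The derivation is extended step by step along
  \<open>\<complex> \<subseteq> \<complex>[t] \<subseteq> \<complex>(t) \<subseteq> \<complex>(t)[x] \<subseteq> \<complex>(t)[x,y] \<subseteq> \<complex>(t)(x,y)\<close>.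
\<close>

definition deriv_along :: "('a::idom \<Rightarrow> 'b::field) \<Rightarrow> ('a \<Rightarrow> 'b) \<Rightarrow> bool" where
  "deriv_along h d \<longleftrightarrow>
     (\<forall>a b. h (a + b) = h a + h b) \<and> (\<forall>a b. h (a * b) = h a * h b) \<and> h 1 = 1 \<and>
     (\<forall>a b. d (a + b) = d a + d b) \<and> (\<forall>a b. d (a * b) = d a * h b + h a * d b)"

lemma deriv_along_0:
  assumes "deriv_along h d"
  shows "h 0 = 0" "d 0 = 0"
  using assms unfolding deriv_along_def by (metis add_cancel_right_left)+

lemma deriv_along_1:
  assumes "deriv_along h d"
  shows "d 1 = 0"
proof -
  have "d (1 * 1) = d 1 * h 1 + h 1 * d 1" "h 1 = 1"
    using assms unfolding deriv_along_def by blast+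
  then have "d 1 = d 1 + d 1" by simp
  then show ?thesis by (metis add_cancel_right_left)
qed

lemma deriv_along_poly:
  fixes h :: "'a::idom \<Rightarrow> 'b::field" and h' :: "'a poly \<Rightarrow> 'b"
  assumes d: "deriv_along h d"
    and add: "\<And>p q. h' (p + q) = h' p + h' q"
    and mult: "\<And>p q. h' (p * q) = h' p * h' q"
    and const: "\<And>a. h' [:a:] = h a"
    and X: "h' [:0, 1:] = X"
  shows "\<exists>d'. deriv_along h' d' \<and> (\<forall>a. d' [:a:] = d a) \<and> d' [:0, 1:] = F"
proof -
  note z = deriv_along_0[OF d]
  have d_add: "d (a + b) = d a + d b" and d_mult: "d (a * b) = d a * h b + h a * d b" for a b
    using d by (auto simp: deriv_along_def)
  note d1 = deriv_along_1[OF d]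
  have h'_pCons: "h' (pCons a p) = h a + X * h' p" for a p
  proof -
    have "pCons a p = [:a:] + [:0, 1:] * p" by simp
    then show ?thesis using add mult const X by metis
  qed
  have h'_smult: "h' (Polynomial.smult a p) = h a * h' p" for a p
  proof -
    have "Polynomial.smult a p = [:a:] * p" by simp
    then show ?thesis using mult const by metis
  qed
  have h'_0: "h' 0 = 0" using const[of 0] z by simp
  define d' where "d' = (\<lambda>p. poly (map_poly d p) X + F * h' (pderiv p))"
  have d'_pCons: "d' (pCons a p) = d a + F * h' p + X * d' p" for a p
    by (simp add: d'_def map_poly_pCons z pderiv_pCons add h'_pCons algebra_simps)
  have d'_0: "d' 0 = 0"
    by (simp add: d'_def h'_0)
  have d'_add: "d' (p + q) = d' p + d' q" for p q
  proof -
    have "map_poly d (p + q) = map_poly d p + map_poly d q"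
      by (rule poly_eqI) (simp add: coeff_map_poly z d_add)
    then show ?thesis by (simp add: d'_def pderiv_add add algebra_simps)
  qed
  have d'_smult: "d' (Polynomial.smult a q) = d a * h' q + h a * d' q" for a q
    by (induction q) (simp_all add: d'_0 h'_0 d'_pCons h'_pCons h'_smult d_mult algebra_simps)
  have d'_mult: "d' (p * q) = d' p * h' q + h' p * d' q" for p q
    by (induction p)
       (simp_all add: d'_0 h'_0 d'_add d'_smult d'_pCons h'_pCons mult z algebra_simps)
  have "h' 1 = 1"
    using const[of 1] d by (simp add: one_pCons deriv_along_def)
  then have "deriv_along h' d'"
    using d'_add d'_mult add mult by (simp add: deriv_along_def)
  moreover have "d' [:a:] = d a" for a
    by (simp add: d'_pCons d'_0 h'_0)
  moreover have "d' [:0, 1:] = F"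
    using const[of 1] d by (simp add: d'_pCons d'_0 h'_0 z d1 deriv_along_def h'_pCons)
  ultimately show ?thesis by blast
qed

lemma deriv_along_fract:
  fixes h :: "'a::idom \<Rightarrow> 'b::field" and h' :: "'a fract \<Rightarrow> 'b"
  assumes d: "deriv_along h d"
    and add: "\<And>p q. h' (p + q) = h' p + h' q"
    and mult: "\<And>p q. h' (p * q) = h' p * h' q"
    and const: "\<And>a. h' (to_fract a) = h a"
    and inj: "\<And>a. h a = 0 \<Longrightarrow> a = 0"
  shows "\<exists>d'. deriv_along h' d' \<and> (\<forall>a. d' (to_fract a) = d a)"
proof -
  note z = deriv_along_0[OF d]
  have h_mult: "h (a * b) = h a * h b" and h_add: "h (a + b) = h a + h b"
    and d_add: "d (a + b) = d a + d b" and d_mult: "d (a * b) = d a * h b + h a * d b"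
    and h1: "h 1 = 1" for a b
    using d by (auto simp: deriv_along_def)
  note d1 = deriv_along_1[OF d]
  define q where "q = (\<lambda>a b. (d a * h b - h a * d b) / (h b)\<^sup>2)"
  have q_cong: "q a b = q a' b'" if "Fract a b = Fract a' b'" "b \<noteq> 0" "b' \<noteq> 0" for a b a' b'
  proof -
    have e: "a * b' = a' * b" using that by (simp add: eq_fract)
    have nz: "h b \<noteq> 0" "h b' \<noteq> 0" using inj that by auto
    have e1: "h a * h b' = h a' * h b" using e h_mult by metis
    have e2: "d a * h b' + h a * d b' = d a' * h b + h a' * d b" using e d_mult by metis
    have e3: "h a = h a' * h b / h b'" using e1 nz by (simp add: field_simps)
    have e4: "d a = (d a' * h b + h a' * d b - h a * d b') / h b'"
      using e2 nz by (simp add: field_simps)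
    show ?thesis unfolding q_def e4 e3 using nz by (simp add: field_simps power2_eq_square)
  qed
  define d' where "d' = (\<lambda>r. let (a, b) = (SOME (a, b). r = Fract a b \<and> b \<noteq> 0) in q a b)"
  have d'_Fract: "d' (Fract a b) = q a b" if "b \<noteq> 0" for a b
  proof -
    let ?P = "\<lambda>(a', b'). Fract a b = Fract a' b' \<and> b' \<noteq> 0"
    obtain a' b' where ab: "Eps ?P = (a', b')" by fastforce
    have "?P (Eps ?P)" by (rule someI[of ?P "(a, b)"]) (use that in simp)
    then have "Fract a b = Fract a' b'" "b' \<noteq> 0" unfolding ab by simp_all
    then have "q a' b' = q a b" using q_cong[OF _ that] by metis
    then show ?thesis by (simp only: d'_def Let_def ab prod.case)
  qed
  have h'_Fract: "h' (Fract a b) = h a / h b" if "b \<noteq> 0" for a b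
  proof -
    have "Fract a b * to_fract b = to_fract a"
      using that by (simp add: Fract_conv_to_fract)
    then have "h' (Fract a b) * h b = h a" using mult const by metis
    moreover have "h b \<noteq> 0" using inj that by blast
    ultimately show ?thesis by (simp add: eq_divide_eq)
  qed
  have d'_add: "d' (u + v) = d' u + d' v" for u v
  proof (cases u, cases v)
    fix a b a' b' assume *: "u = Fract a b" "b \<noteq> 0" "v = Fract a' b'" "b' \<noteq> 0"
    have nz: "h b \<noteq> 0" "h b' \<noteq> 0" using inj * by auto
    show ?thesis
      using * nz
      by (simp add: d'_Fract q_def h_mult h_add d_mult d_add field_simps power2_eq_square)
  qed
  have d'_mult: "d' (u * v) = d' u * h' v + h' u * d' v" for u v
  proof (cases u, cases v)
    fix a b a' b' assume *: "u = Fract a b" "b \<noteq> 0" "v = Fract a' b'" "b' \<noteq> 0"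
    have nz: "h b \<noteq> 0" "h b' \<noteq> 0" using inj * by auto
    show ?thesis
      using * nz
      by (simp add: d'_Fract h'_Fract q_def h_mult h_add d_mult d_add field_simps power2_eq_square)
  qed
  have "h' 1 = 1" using const[of 1] h1 by simp
  then have "deriv_along h' d'"
    using d'_add d'_mult add mult by (simp add: deriv_along_def)
  moreover have "d' (to_fract a) = d a" for a
    by (simp add: to_fract_def d'_Fract q_def h1 d1)
  ultimately show ?thesis by blast
qed

lemma time_derivative_exists:
  "\<exists>D. is_time_derivative D \<and> D \<x> = F \<and> D \<y> = G"
proof -
  have emb_add: "emb (a + b) = emb a + emb b" and emb_mult: "emb (a * b) = emb a * emb b" for a b
    by (simp_all add: emb_def flip: to_fract_add to_fract_mult)
  have cst_add: "cst (a + b) = cst a + cst b" and cst_mult: "cst (a * b) = cst a * cst b" for a b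
    by (simp_all add: cst_def flip: to_fract_add to_fract_mult)
  have one: "emb 1 = 1" "cst 1 = 1"
    by (simp_all add: emb_def cst_def flip: one_pCons)
  have d0: "deriv_along (\<lambda>c. emb (cst c)) (\<lambda>_. 0)"
    by (simp add: deriv_along_def one cst_add cst_mult emb_add emb_mult)
  have "\<exists>d1. deriv_along (\<lambda>p. emb (to_fract p)) d1 \<and> (\<forall>c. d1 [:c:] = 0) \<and> d1 [:0, 1:] = 1"
    by (rule deriv_along_poly[OF d0]) (simp_all only: to_fract_add to_fract_mult emb_add emb_mult cst_def)
  then obtain d1 where d1: "deriv_along (\<lambda>p. emb (to_fract p)) d1"
    "\<And>c. d1 [:c:] = 0" "d1 [:0, 1:] = 1" by blast
  have "\<exists>d2. deriv_along emb d2 \<and> (\<forall>p. d2 (to_fract p) = d1 p)"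
    by (rule deriv_along_fract[OF d1(1)]) (simp_all add: emb_add emb_mult, simp add: emb_def)
  then obtain d2 where d2: "deriv_along emb d2" "\<And>p. d2 (to_fract p) = d1 p" by blast
  have "\<exists>d3. deriv_along (\<lambda>p. to_fract [:p:]) d3 \<and> (\<forall>a. d3 [:a:] = d2 a) \<and> d3 [:0, 1:] = F"
    by (rule deriv_along_poly[OF d2(1)]) (simp_all add: emb_def flip: to_fract_add to_fract_mult)
  then obtain d3 where d3: "deriv_along (\<lambda>p. to_fract [:p:]) d3"
    "\<And>a. d3 [:a:] = d2 a" "d3 [:0, 1:] = F" by blast
  have "\<exists>d4. deriv_along to_fract d4 \<and> (\<forall>a. d4 [:a:] = d3 a) \<and> d4 [:0, 1:] = G"
    by (rule deriv_along_poly[OF d3(1)]) simp_all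
  then obtain d4 where d4: "deriv_along to_fract d4" "\<And>a. d4 [:a:] = d3 a" "d4 [:0, 1:] = G"
    by blast
  have "\<exists>D. deriv_along (\<lambda>u. u) D \<and> (\<forall>a. D (to_fract a) = d4 a)"
    by (rule deriv_along_fract[OF d4(1)]) simp_all
  then obtain D where D: "deriv_along (\<lambda>u. u) D" "\<And>a. D (to_fract a) = d4 a" by blast
  have "is_time_derivative D \<and> D \<x> = F \<and> D \<y> = G"
    using D(1)
    by (simp add: is_time_derivative_def deriv_along_def emb_def cst_def tvar_def xvar_def yvar_def
        D(2) d4 d3 d2 d1)
  then show ?thesis by blast
qed

lemma is_system_S_exists: "\<exists>D. is_system_S \<alpha>2 a D"
  using time_derivative_exists[of "S_rhs_x \<alpha>2 a" "S_rhs_y \<alpha>2 a"] by (auto simp: is_system_S_def)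

end

theory Submission
  imports Defs
begin

text \<open>
  Write the system as \<open>dx/dt = A(x) y + B(x)\<close>, \<open>dy/dt = C(x) y\<^sup>2 + E(x) y + e\<close> with
  \<open>A = a\<^sub>1 x\<^sup>3 + a\<^sub>2 x\<^sup>2 + a\<^sub>5 x + a\<^sub>7\<close>, \<open>B = b\<^sub>2 x\<^sup>2 + b\<^sub>1 x + b\<^sub>0\<close> and
  \<open>C = a\<^sub>3 x\<^sup>2 + a\<^sub>9 x + a\<^sub>1\<^sub>0\<close>; here \<open>b\<^sub>0 = a\<^sub>8\<close>, while \<open>E\<close> and \<open>e\<close> are determined by
  \<open>A\<close>, \<open>B\<close>, \<open>C\<close> and \<open>\<alpha>\<^sub>2\<close>. It suffices to find \<open>A\<close>, \<open>B\<close> and \<open>C\<close>.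

  In the coordinates \<open>(x - c, 1/y)\<close> the local form has linear part \<open>A'(c) X + (B(c) - dc/dt) Y\<close>,
  constant terms \<open>A(c)\<close> and \<open>- C(c)\<close>. So a scheme entry \<open>f (n, \<alpha>; 0, 1)\<close> at \<open>c\<close> says
  \<open>A(c) = 0\<close>, \<open>A'(c) = f n\<close>, \<open>B(c) - dc/dt = f \<alpha>\<close> and \<open>C(c) = - f\<close>
  (\<open>local_form_finite\<close>). At infinity it says \<open>a\<^sub>1 = f\<^sub>3 n\<^sub>4\<close>,
  \<open>\<alpha>\<^sub>2 a\<^sub>1 - b\<^sub>2 = f\<^sub>3 \<alpha>\<^sub>1\<close> and \<open>2 a\<^sub>1 + a\<^sub>3 = f\<^sub>3\<close> (\<open>local_form_infinity\<close>). Reading off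
  coefficients is legitimate because the local coordinates are algebraically independent over
  \<open>\<complex>(t)\<close>, so that the local form is unique (\<open>linear_approximation_scheme_matrixD\<close>).

  The rest is interpolation (\<open>coefficients_determined\<close>). The cubic \<open>A\<close> vanishes at \<open>0, 1, t\<close>, so
  \<open>A = a\<^sub>1 x (x - 1) (x - t)\<close>, and the three values of \<open>A'\<close> give \<open>f\<^sub>0, f\<^sub>1, f\<^sub>2\<close> as
  multiples of \<open>a\<^sub>1\<close>. Interpolating \<open>C\<close> at \<open>0, 1, t\<close> gives \<open>a\<^sub>3 = - a\<^sub>1 (1/n\<^sub>1 + 1/n\<^sub>2 + 1/n\<^sub>3)\<close>,
  hence \<open>f\<^sub>3 = 2 a\<^sub>1 + a\<^sub>3 = a\<^sub>1 \<kappa> / (n\<^sub>1 n\<^sub>2 n\<^sub>3)\<close>. The leading coefficient of \<open>B\<close> is now known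
  twice: from infinity, and by interpolation at \<open>0, 1, t\<close>, where \<open>dt/dt = 1\<close> makes the
  interpolation inhomogeneous in \<open>a\<^sub>1\<close>. Comparing the two gives
  \<open>\<delta> t (t - 1) a\<^sub>1 = - n\<^sub>1 n\<^sub>2 n\<^sub>3\<close>, and with it every coefficient.
\<close>

section \<open>The embeddings \<open>\<complex> \<subseteq> \<complex>(t) \<subseteq> \<complex>(t)(x,y)\<close>\<close>

lemma emb_0 [simp]: "emb 0 = 0"
  by (simp add: emb_def)

lemma emb_1 [simp]: "emb 1 = 1"
  by (simp add: emb_def flip: one_pCons)

lemma emb_add: "emb (a + b) = emb a + emb b"
  by (simp add: emb_def flip: to_fract_add)

lemma emb_mult: "emb (a * b) = emb a * emb b"
  by (simp add: emb_def flip: to_fract_mult)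

lemma emb_minus: "emb (- a) = - emb a"
  by (simp add: emb_def flip: to_fract_uminus)

lemma emb_diff: "emb (a - b) = emb a - emb b"
  by (simp add: emb_def flip: to_fract_diff)

lemma emb_2: "emb 2 = 2"
  using emb_add[of 1 1] by simp

lemma emb_3: "emb 3 = 3"
  using emb_add[of 2 1] by (simp add: emb_2)

lemma emb_power: "emb (a ^ k) = emb a ^ k"
  by (induction k) (simp_all add: emb_mult)

lemmas emb_hom = emb_add emb_mult emb_minus emb_diff emb_2 emb_3 emb_power

lemma cst_0 [simp]: "cst 0 = 0"
  by (simp add: cst_def)

lemma cst_1 [simp]: "cst 1 = 1"
  by (simp add: cst_def flip: one_pCons)

lemma cst_add: "cst (a + b) = cst a + cst b"
  by (simp add: cst_def flip: to_fract_add)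

lemma cst_mult: "cst (a * b) = cst a * cst b"
  by (simp add: cst_def flip: to_fract_mult)

lemma cst_minus: "cst (- a) = - cst a"
  by (simp add: cst_def flip: to_fract_uminus)

lemma cst_diff: "cst (a - b) = cst a - cst b"
  by (simp add: cst_def flip: to_fract_diff)

lemma cst_2: "cst 2 = 2"
  using cst_add[of 1 1] by simp

lemmas cst_hom = cst_add cst_mult cst_minus cst_diff cst_2

lemma cst_eq_0_iff [simp]: "cst c = 0 \<longleftrightarrow> c = 0"
  by (simp add: cst_def)

lemma two_neq_0: "(2 :: ratfun) \<noteq> 0"
  using cst_eq_0_iff[of 2] by (simp add: cst_2)

lemma tvar_neq: "\<t> \<noteq> 0" "\<t> \<noteq> 1"
  by (simp_all add: tvar_def one_pCons flip: to_fract_1)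

lemma xvar_neq_0: "\<x> \<noteq> 0" and yvar_neq_0: "\<y> \<noteq> 0"
  by (simp_all add: xvar_def yvar_def)


section \<open>Evaluation of polynomials at rational functions\<close>

definition ueval :: "ratfun poly \<Rightarrow> ratfun_xy \<Rightarrow> ratfun_xy"
  where "ueval p X = poly (map_poly emb p) X"

lemma ueval_0 [simp]: "ueval 0 X = 0"
  by (simp add: ueval_def)

lemma ueval_pCons [simp]: "ueval (pCons a p) X = emb a + X * ueval p X"
  by (simp add: ueval_def map_poly_pCons)

lemma ueval_add: "ueval (p + q) X = ueval p X + ueval q X"
proof -
  have "map_poly emb (p + q) = map_poly emb p + map_poly emb q"
    by (rule poly_eqI) (simp add: coeff_map_poly emb_add)
  then show ?thesis by (simp add: ueval_def)
qed

lemma ueval_diff: "ueval (p - q) X = ueval p X - ueval q X"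
  using ueval_add[of "p - q" q X] by (simp add: algebra_simps)

lemma ueval_smult: "ueval (Polynomial.smult a p) X = emb a * ueval p X"
  by (induction p) (simp_all add: emb_mult algebra_simps)

lemma ueval_mult: "ueval (p * q) X = ueval p X * ueval q X"
  by (induction p) (simp_all add: ueval_add ueval_smult algebra_simps)

lemma ueval_monom_1: "ueval (monom 1 k) X = X ^ k"
  by (induction k) (simp_all add: monom_0 monom_Suc)

lemma bieval_eq: "bieval P X Y = poly (map_poly (\<lambda>p. ueval p X) P) Y"
  by (simp add: bieval_def ueval_def)

lemma bieval_0 [simp]: "bieval 0 X Y = 0"
  by (simp add: bieval_eq)

lemma bieval_pCons [simp]: "bieval (pCons p P) X Y = ueval p X + Y * bieval P X Y"
  by (simp add: bieval_eq map_poly_pCons)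

lemma bieval_diff: "bieval (P - Q) X Y = bieval P X Y - bieval Q X Y"
proof -
  have "map_poly (\<lambda>p. ueval p X) (P - Q) = map_poly (\<lambda>p. ueval p X) P - map_poly (\<lambda>p. ueval p X) Q"
    by (rule poly_eqI) (simp add: coeff_map_poly ueval_diff)
  then show ?thesis by (simp add: bieval_eq)
qed

text \<open>
  The map \<open>h\<close> need not be injective, so the degree of a polynomial may drop under it. This is why
  both sides are compared as sums up to \<open>degree p\<close>.
\<close>

lemma poly_map_poly_reflect_poly:
  fixes h :: "'a :: comm_semiring_1 \<Rightarrow> 'b :: field"
  assumes "h 0 = 0" and "Y \<noteq> 0"
  shows "poly (map_poly h (reflect_poly p)) Y = Y ^ degree p * poly (map_poly h p) (1 / Y)"
proof -
  have sum: "poly (map_poly h q) y = (\<Sum>i\<le>degree p. h (coeff q i) * y ^ i)"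
    if "degree q \<le> degree p" for q y
  proof -
    have "poly (map_poly h q) y = (\<Sum>i\<le>degree (map_poly h q). h (coeff q i) * y ^ i)"
      by (simp add: poly_altdef coeff_map_poly assms(1))
    also have "\<dots> = (\<Sum>i\<le>degree p. h (coeff q i) * y ^ i)"
    proof (rule sum.mono_neutral_left)
      show "{..degree (map_poly h q)} \<subseteq> {..degree p}"
        using that map_poly_degree_leq[of h q] by auto
      show "\<forall>i\<in>{..degree p} - {..degree (map_poly h q)}. h (coeff q i) * y ^ i = 0"
      proof
        fix i assume "i \<in> {..degree p} - {..degree (map_poly h q)}"
        then have "coeff (map_poly h q) i = 0" by (intro coeff_eq_0) auto
        then show "h (coeff q i) * y ^ i = 0" by (simp add: coeff_map_poly assms(1))
      qed
    qed simp
    finally show ?thesis .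
  qed
  have "poly (map_poly h (reflect_poly p)) Y
      = (\<Sum>i\<le>degree p. h (coeff p (degree p - i)) * Y ^ i)"
    by (simp add: sum degree_reflect_poly_le coeff_reflect_poly)
  also have "\<dots> = (\<Sum>i\<le>degree p. h (coeff p i) * Y ^ (degree p - i))"
    by (rule sum.reindex_bij_witness[of _ "\<lambda>i. degree p - i" "\<lambda>i. degree p - i"]) auto
  also have "\<dots> = Y ^ degree p * (\<Sum>i\<le>degree p. h (coeff p i) * (1 / Y) ^ i)"
    unfolding sum_distrib_left
    using assms(2) by (intro sum.cong) (auto simp: power_diff power_one_over field_simps)
  also have "\<dots> = Y ^ degree p * poly (map_poly h p) (1 / Y)"
    by (simp add: sum)
  finally show ?thesis .
qed


section \<open>Algebraic independence of the local coordinates\<close>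

definition alg_indep :: "ratfun_xy \<Rightarrow> ratfun_xy \<Rightarrow> bool"
  where "alg_indep X Y \<longleftrightarrow> (\<forall>P. bieval P X Y = 0 \<longrightarrow> P = 0)"

text \<open>
  Replacing the second variable by a polynomial \<open>q\<close> that really involves it is an injective
  substitution. This is the source of all independence below: both \<open>\<y>\<close> and the coordinate at
  infinity \<open>- (\<x> * \<y> + \<alpha>\<^sub>2) * \<x>\<close> are of this kind, and the remaining changes of coordinates are
  shifts and reciprocals.
\<close>

lemma bieval_xvar: "bieval P \<x> (to_fract q) = to_fract (pcompose P q)"
proof (induction P)
  case (pCons p P)
  have "ueval p \<x> = to_fract [:p:]"
    by (induction p) (simp_all add: emb_def xvar_def flip: to_fract_add to_fract_mult)
  then show ?case
    using pCons by (simp add: pcompose_pCons flip: to_fract_add to_fract_mult)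
qed simp

lemma alg_indep_xvar:
  assumes "degree q > 0"
  shows "alg_indep \<x> (to_fract q)"
  using assms by (simp add: alg_indep_def bieval_xvar pcompose_eq_0_iff)

lemma alg_indep_shift:
  assumes "alg_indep X Y"
  shows "alg_indep (X - emb c) Y"
  unfolding alg_indep_def
proof (intro allI impI)
  fix P assume P: "bieval P (X - emb c) Y = 0"
  let ?Q = "map_poly (\<lambda>p. pcompose p [:- c, 1:]) P"
  have u: "ueval (pcompose p [:- c, 1:]) X = ueval p (X - emb c)" for p
    by (induction p) (simp_all add: pcompose_pCons ueval_add ueval_diff ueval_smult emb_minus algebra_simps)
  have "bieval ?Q X Y = bieval P (X - emb c) Y"
    by (induction P) (simp_all add: map_poly_pCons u)
  then have "?Q = 0" using P assms by (simp add: alg_indep_def)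
  then show "P = 0"
    by (subst (asm) map_poly_eq_0_iff) (auto simp: pcompose_eq_0_iff)
qed

lemma alg_indep_inverse_snd:
  assumes "alg_indep X Y" "Y \<noteq> 0"
  shows "alg_indep X (1 / Y)"
  unfolding alg_indep_def
proof (intro allI impI)
  fix P assume "bieval P X (1 / Y) = 0"
  then have "bieval (reflect_poly P) X Y = 0"
    using assms(2) by (simp add: bieval_eq poly_map_poly_reflect_poly)
  then have "reflect_poly P = 0" using assms(1) unfolding alg_indep_def by blast
  then show "P = 0" by simp
qed

text \<open>
  A relation for \<open>1 / X\<close> becomes one for \<open>X\<close> after multiplication by a power \<open>X ^ M\<close>. Since the
  coefficients of \<open>P\<close> have different degrees, one \<open>M\<close> must serve all of them, and reversing a
  coefficient is followed by padding with \<open>X ^ (M - degree p)\<close>.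
\<close>

lemma alg_indep_inverse_fst:
  assumes "alg_indep X Y" "X \<noteq> 0"
  shows "alg_indep (1 / X) Y"
  unfolding alg_indep_def
proof (intro allI impI)
  fix P :: bipoly assume P: "bieval P (1 / X) Y = 0"
  define M where "M = (\<Sum>j\<le>degree P. degree (coeff P j))"
  define r where "r = (\<lambda>p :: ratfun poly. monom 1 (M - degree p) * reflect_poly p)"
  have [simp]: "r 0 = 0" by (simp add: r_def)
  have M: "degree (coeff P j) \<le> M" for j
  proof (cases "j \<le> degree P")
    case True
    then show ?thesis unfolding M_def by (intro member_le_sum) auto
  qed (simp add: coeff_eq_0)
  have r: "ueval (r p) X = X ^ M * ueval p (1 / X)" if "degree p \<le> M" for p
  proof -
    have "ueval (reflect_poly p) X = X ^ degree p * ueval p (1 / X)"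
      unfolding ueval_def by (rule poly_map_poly_reflect_poly) (simp_all add: assms(2))
    then show ?thesis
      using that by (simp add: r_def ueval_mult ueval_monom_1 flip: power_add mult.assoc)
  qed
  have "bieval (map_poly r Q) X Y = X ^ M * bieval Q (1 / X) Y"
    if "\<And>j. degree (coeff Q j) \<le> M" for Q
    using that
  proof (induction Q)
    case (pCons q Q)
    have "degree q \<le> M" using pCons.prems[of 0] by simp
    moreover have "degree (coeff Q j) \<le> M" for j using pCons.prems[of "Suc j"] by simp
    ultimately show ?case
      using pCons.IH by (simp add: map_poly_pCons r algebra_simps)
  qed simp
  from this[OF M] have "map_poly r P = 0"
    using P assms(1) by (simp add: alg_indep_def)
  then show "P = 0"
    by (subst (asm) map_poly_eq_0_iff) (auto simp: r_def)
qed

lemma alg_indep_finite_coords: "alg_indep (\<x> - emb c) (1 / \<y>)"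
proof -
  have "alg_indep \<x> \<y>" unfolding yvar_def by (rule alg_indep_xvar) simp
  then show ?thesis by (intro alg_indep_inverse_snd alg_indep_shift yvar_neq_0)
qed

lemma alg_indep_infinity_coords:
  "- (\<x> * \<y> + emb b) * \<x> \<noteq> 0" "alg_indep (1 / \<x>) (1 / (- (\<x> * \<y> + emb b) * \<x>))"
proof -
  let ?q = "[:[:0, - b:], [:0, 0, - 1:]:] :: bipoly"
  have q: "- (\<x> * \<y> + emb b) * \<x> = to_fract ?q"
    by (simp add: xvar_def yvar_def emb_def
        flip: to_fract_add to_fract_mult to_fract_uminus)
  have "degree ?q > 0" by simp
  then have "alg_indep \<x> (to_fract ?q)" by (rule alg_indep_xvar)
  moreover show nz: "- (\<x> * \<y> + emb b) * \<x> \<noteq> 0" unfolding q by simp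
  ultimately show "alg_indep (1 / \<x>) (1 / (- (\<x> * \<y> + emb b) * \<x>))"
    using q xvar_neq_0 by (metis alg_indep_inverse_fst alg_indep_inverse_snd)
qed

text \<open>
  The polynomials witnessing the linear approximation agree with any other local form, by
  algebraic independence; hence the scheme entry can be read off from an explicit one.
\<close>

lemma linear_approximation_scheme_matrixD:
  assumes lin: "linear_approximation D (X, Y) (scheme_matrix f n \<alpha>)"
    and indep: "alg_indep X Y" and Y: "Y \<noteq> 0"
    and loc: "has_local_form D (X, Y) G H"
  shows "bicoeff G 0 0 = 0" "bicoeff G 1 0 = f * cst n" "bicoeff G 0 1 = f * cst \<alpha>"
    "bicoeff H 0 0 = f"
proof -
  obtain G' H' where GH: "has_local_form D (X, Y) G' H'" "bicoeff G' 0 0 = 0"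
    and M: "scheme_matrix f n \<alpha> = mat_of_rows_list 2
      [[bicoeff G' 1 0, bicoeff G' 0 1], [0, bicoeff H' 0 0]]"
    using lin unfolding linear_approximation_def by blast
  have "bieval (G - G') X Y = 0" "bieval (H - H') X Y = 0"
    using loc GH(1) Y by (simp_all add: has_local_form_def bieval_diff)
  then have eq: "G' = G" "H' = H"
    using indep unfolding alg_indep_def by force+
  have "scheme_matrix f n \<alpha> $$ (i, j) = mat_of_rows_list 2
      [[bicoeff G 1 0, bicoeff G 0 1], [0, bicoeff H 0 0]] $$ (i, j)" for i j
    using M by (simp add: eq)
  from this[of 0 0] this[of 0 1] this[of 1 1]
  show "bicoeff G 1 0 = f * cst n" "bicoeff G 0 1 = f * cst \<alpha>" "bicoeff H 0 0 = f"
    by (simp_all add: scheme_matrix_def mat_of_rows_list_def)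
  show "bicoeff G 0 0 = 0" using GH eq by simp
qed


section \<open>Local forms\<close>

lemma time_derivative_rules:
  assumes "is_time_derivative D"
  shows "D (u + v) = D u + D v" "D (u * v) = D u * v + u * D v"
    "D (emb (cst c)) = 0" "D (emb \<t>) = 1" "D (- u) = - D u" "D (u - v) = D u - D v"
    "u \<noteq> 0 \<Longrightarrow> D (1 / u) = - D u / u\<^sup>2"
proof -
  have add: "D (u + v) = D u + D v" and mult: "D (u * v) = D u * v + u * D v"
    and c: "D (emb (cst c)) = 0" for u v c
    using assms by (auto simp: is_time_derivative_def)
  show "D (u + v) = D u + D v" "D (u * v) = D u * v + u * D v"
    "D (emb (cst c)) = 0" "D (emb \<t>) = 1"
    using assms by (auto simp: is_time_derivative_def)
  have D01: "D 0 = 0" "D 1 = 0" using c[of 0] c[of 1] by simp_all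
  have minus: "D (- u) = - D u" for u
    using add[of u "- u"] by (simp add: D01 eq_neg_iff_add_eq_0 add.commute)
  show "D (- u) = - D u" by (rule minus)
  show "D (u - v) = D u - D v"
    using add[of u "- v"] by (simp add: minus)
  show "D (1 / u) = - D u / u\<^sup>2" if "u \<noteq> 0"
    using mult[of u "1 / u"] that D01
    by (simp add: field_simps power2_eq_square eq_neg_iff_add_eq_0)
qed

text \<open>
  The two polynomials are \<open>A(X + c) + Y (B(X + c) - c')\<close> and \<open>- C(X + c) - Y E(X + c) - Y\<^sup>2 e\<close>
  (Taylor expansions at \<open>c\<close>), where \<open>A, B, C, E\<close> collect the coefficients of the powers of \<open>y\<close>.
\<close>

lemma local_form_finite:
  assumes D: "is_time_derivative D"
    and Dx: "D \<x> = (emb a1 * \<x> ^ 3 + emb a2 * \<x> ^ 2 + emb a5 * \<x> + emb a7) * \<y>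
                    + emb b2 * \<x> ^ 2 + emb b1 * \<x> + emb b0"
    and Dy: "D \<y> = (emb a3 * \<x> ^ 2 + emb a9 * \<x> + emb a10) * \<y> ^ 2
                    + (emb a4 * \<x> + emb a6) * \<y> + emb e"
    and Dc: "D (emb c) = emb c'"
  shows "has_local_form D (\<x> - emb c, 1 / \<y>)
     [:[:a1 * c ^ 3 + a2 * c ^ 2 + a5 * c + a7, 3 * a1 * c ^ 2 + 2 * a2 * c + a5, 3 * a1 * c + a2, a1:],
       [:b2 * c ^ 2 + b1 * c + b0 - c', 2 * b2 * c + b1, b2:]:]
     [:[:- (a3 * c ^ 2 + a9 * c + a10), - (2 * a3 * c + a9), - a3:],
       [:- (a4 * c + a6), - a4:], [:- e:]:]"
proof -
  note rules = time_derivative_rules[OF D]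
  have DX: "D (\<x> - emb c) = D \<x> - emb c'" by (simp add: rules Dc)
  have DY: "D (1 / \<y>) = - D \<y> / \<y>\<^sup>2" by (simp add: rules yvar_neq_0)
  define X where "X = \<x> - emb c"
  have x: "\<x> = X + emb c" by (simp add: X_def)
  show ?thesis
    unfolding has_local_form_def prod.case DX DY Dx Dy unfolding X_def[symmetric] unfolding x
    using yvar_neq_0
    by (simp add: emb_hom divide_simps) (simp add: algebra_simps power2_eq_square power3_eq_cube)
qed

text \<open>
  The assumptions on \<open>a4\<close>, \<open>a6\<close> and \<open>e\<close> are the constraints built into the system, with the
  coefficients \<open>b2\<close>, \<open>b1\<close> of \<open>x\<^sup>2\<close>, \<open>x\<close> as parameters, which avoids halves. Substituting
  \<open>\<x> = 1 / u\<close> and \<open>\<y> = - (u\<^sup>2 / v + \<alpha>\<^sub>2 u)\<close> produces negative powers of \<open>u\<close> in \<open>D v\<close>; their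
  coefficients vanish precisely because of these constraints.
\<close>

lemma local_form_infinity:
  assumes D: "is_time_derivative D"
    and Dx: "D \<x> = (emb a1 * \<x> ^ 3 + emb a2 * \<x> ^ 2 + emb a5 * \<x> + emb a7) * \<y>
                    + emb b2 * \<x> ^ 2 + emb b1 * \<x> + emb b0"
    and Dy: "D \<y> = (emb a3 * \<x> ^ 2 + emb a9 * \<x> + emb a10) * \<y> ^ 2
                    + (emb a4 * \<x> + emb a6) * \<y> + emb e"
    and al: "al = cst \<alpha>2"
    and a4: "a4 = (3 * a1 + 2 * a3) * al - 2 * b2"
    and a6: "a6 = (a2 + a9) * al - b1"
    and e: "e = ((2 * a1 + a3) * al - b2) * al"
  shows "has_local_form D (infinity_coords \<alpha>2)
     [:[:0, a1, a2, a5, a7:], [:al * a1 - b2, al * a2 - b1, al * a5 - b0, al * a7:]:]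
     [:[:2 * a1 + a3, 2 * a2 + a9, 2 * a5 + a10, 2 * a7:],
       [:al * a2 + a6, 3 * al * a5 - 2 * b0 + 2 * al * a10, 3 * al * a7:],
       [:al * (al * a5 - b0 + al * a10), al * al * a7:]:]"
proof -
  note rules = time_derivative_rules[OF D]
  define y1 where "y1 = - (\<x> * \<y> + emb al) * \<x>"
  have y1: "y1 \<noteq> 0" unfolding y1_def by (rule alg_indep_infinity_coords)
  define u where "u = 1 / \<x>"
  define v where "v = 1 / y1"
  have nz: "u \<noteq> 0" "v \<noteq> 0" using y1 xvar_neq_0 by (simp_all add: u_def v_def)
  have x: "\<x> = 1 / u" by (simp add: u_def)
  have y: "\<y> = - (u\<^sup>2 / v + emb al * u)"
    using y1 xvar_neq_0 unfolding u_def v_def by (simp add: y1_def field_simps power2_eq_square)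
  have coords: "infinity_coords \<alpha>2 = (u, v)"
    by (simp add: infinity_coords_def Let_def u_def v_def y1_def al)
  have Du: "D u = - D \<x> * u\<^sup>2"
    unfolding u_def by (simp add: rules xvar_neq_0 power_one_over field_simps)
  have "D v = - D y1 * v\<^sup>2"
    unfolding v_def by (simp add: rules y1 power_one_over field_simps)
  also have "D y1 = - ((D \<x> * \<y> + \<x> * D \<y>) * \<x> + (\<x> * \<y> + emb al) * D \<x>)"
    by (simp add: y1_def rules al algebra_simps)
  finally have Dv: "D v = ((D \<x> * \<y> + \<x> * D \<y>) * \<x> + (\<x> * \<y> + emb al) * D \<x>) * v\<^sup>2"
    by simp
  show ?thesis
    unfolding has_local_form_def coords prod.case Du Dv Dx Dy unfolding x y a4 a6 e
    using nz
    by (simp add: emb_hom divide_simps) (simp add: algebra_simps power_numeral_reduce)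
qed


section \<open>Interpolation of the coefficients\<close>

text \<open>
  All coefficients are expressed as multiples of \<open>m = a1 / (N1 * N2 * N3)\<close>, which makes them
  polynomial in the data. The two expressions for \<open>b2\<close>, one from infinity and one from
  interpolation, combine to \<open>w * m = - 1\<close>: multiplying by \<open>w\<close> replaces the factor \<open>m\<close> by
  \<open>- 1\<close>.
\<close>

lemma coefficients_determined:
  fixes T :: "'a :: field"
  assumes nz: "N1 \<noteq> 0" "N2 \<noteq> 0" "N3 \<noteq> 0" "T \<noteq> 0" "T \<noteq> 1"
    and G00: "a7 = 0" "a1 + a2 + a5 + a7 = 0" "a1 * T ^ 3 + a2 * T ^ 2 + a5 * T + a7 = 0"
    and G10: "a5 = f0 * N1" "3 * a1 + 2 * a2 + a5 = f1 * N2"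
      "3 * a1 * T ^ 2 + 2 * a2 * T + a5 = f2 * N3"
    and G01: "b0 = f0 * l4" "b2 + b1 + b0 = f1 * l3" "b2 * T ^ 2 + b1 * T + b0 - 1 = f2 * l0"
    and H00: "- a10 = f0" "- (a3 + a9 + a10) = f1" "- (a3 * T ^ 2 + a9 * T + a10) = f2"
    and inf: "al * a1 - b2 = f3 * l1" "2 * a1 + a3 = f3"
    and K: "K = 2 * N1 * N2 * N3 - N1 * N2 - N1 * N3 - N2 * N3"
    and d: "d = N1 * N2 * l0 + K * l1 - N1 * N2 * N3 * al + N1 * N3 * l3 + N2 * N3 * l4"
    and w: "w = d * T * (T - 1)"
  shows "w * a1 = - (N1 * N2 * N3)"
    "w * a2 = (1 + T) * (N1 * N2 * N3)"
    "w * a5 = - (T * (N1 * N2 * N3))"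
    "w * b0 = - (N2 * N3 * l4 * T)"
    "w * b1 = - (K * l1) + N1 * N2 * N3 * al + N1 * N3 * l3 * (T - 1) + N2 * N3 * l4 * T"
    "w * b2 = K * l1 - N1 * N2 * N3 * al"
    "w * a3 = N1 * N2 + N2 * N3 + N1 * N3"
    "w * a9 = - (N1 * N2 + N2 * N3 + (N1 + N2) * N3 * T)"
    "w * a10 = N2 * N3 * T"
proof -
  have T1: "T - 1 \<noteq> 0" using nz by simp
  then have TT1: "T * (T - 1) \<noteq> 0" using nz by simp
  define m where "m = a1 / (N1 * N2 * N3)"
  have a1: "a1 = m * (N1 * N2 * N3)" using nz by (simp add: m_def)
  \<comment> \<open>The cubic has the roots \<open>0\<close>, \<open>1\<close>, \<open>T\<close>, so its other coefficients are multiples of \<open>a1\<close>.\<close>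
  have a5_eq: "a5 = - (a1 + a2)" using minus_unique[of "a1 + a2" a5] G00(1,2) by simp
  have "T * (T - 1) * (a2 + (1 + T) * a1) = a1 * T ^ 3 + a2 * T ^ 2 + a5 * T + a7"
    by (simp add: a5_eq G00(1) algebra_simps power2_eq_square power3_eq_cube)
  also have "\<dots> = 0" by (rule G00(3))
  finally have "T * (T - 1) * (a2 + (1 + T) * a1) = 0" .
  then have a2: "a2 = - ((1 + T) * a1)" using TT1 by (simp add: eq_neg_iff_add_eq_0)
  have a5: "a5 = T * a1" using a5_eq unfolding a2 by (simp add: algebra_simps)
  have "N1 * f0 = a5" unfolding G10(1) by (simp add: ac_simps)
  also have "\<dots> = N1 * (m * N2 * N3 * T)" unfolding a5 a1 by (simp add: ac_simps)
  finally have f0: "f0 = m * N2 * N3 * T" using mult_left_cancel[OF nz(1)] by blast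
  have "N2 * f1 = 3 * a1 + 2 * a2 + a5" unfolding G10(2) by (simp add: ac_simps)
  also have "\<dots> = N2 * (m * N1 * N3 * (1 - T))"
    unfolding a2 a5 a1 by (simp add: algebra_simps)
  finally have f1: "f1 = m * N1 * N3 * (1 - T)" using mult_left_cancel[OF nz(2)] by blast
  have "N3 * f2 = 3 * a1 * T ^ 2 + 2 * a2 * T + a5" unfolding G10(3) by (simp add: ac_simps)
  also have "\<dots> = N3 * (m * N1 * N2 * (T * (T - 1)))"
    unfolding a2 a5 a1 by (simp add: algebra_simps power2_eq_square)
  finally have f2: "f2 = m * N1 * N2 * (T * (T - 1))" using mult_left_cancel[OF nz(3)] by blast
  \<comment> \<open>Lagrange interpolation of the quadratic with leading coefficient \<open>a3\<close> at \<open>0\<close>, \<open>1\<close>, \<open>T\<close>.\<close>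
  have "T * (T - 1) * a3 = f1 * T - f0 * (T - 1) - f2"
    unfolding H00[symmetric] by (simp add: algebra_simps power2_eq_square)
  also have "\<dots> = T * (T - 1) * (- (m * (N1 * N2 + N2 * N3 + N1 * N3)))"
    unfolding f0 f1 f2 by (simp add: algebra_simps)
  finally have a3: "a3 = - (m * (N1 * N2 + N2 * N3 + N1 * N3))"
    using mult_left_cancel[OF TT1] by blast
  have f3: "f3 = m * K"
    unfolding inf(2)[symmetric] a3 a1 K by (simp add: algebra_simps)
  \<comment> \<open>First expression for \<open>b2\<close>, from the point at infinity.\<close>
  have b2: "b2 = m * (N1 * N2 * N3 * al - K * l1)"
    using inf(1) unfolding f3 a1 by (simp add: algebra_simps)
  \<comment> \<open>Second expression for \<open>b2\<close>, by interpolation. The summand \<open>1\<close> is the speed of the point \<open>T\<close>.\<close>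
  have "T * (T - 1) * b2 = f0 * l4 * (T - 1) - f1 * l3 * T + f2 * l0 + 1"
    unfolding G01(1,2,3)[symmetric] by (simp add: algebra_simps power2_eq_square)
  also have "\<dots> = T * (T - 1) * (m * (N2 * N3 * l4 + N1 * N3 * l3 + N1 * N2 * l0)) + 1"
    unfolding f0 f1 f2 by (simp add: algebra_simps)
  finally have "w * m = - 1"
    unfolding b2 w d by (simp add: algebra_simps)
  then have w: "w * (m * z) = - z" for z
    by (simp flip: mult.assoc)
  show "w * a1 = - (N1 * N2 * N3)" unfolding a1 w ..
  have "a2 = m * (- ((1 + T) * (N1 * N2 * N3)))" unfolding a2 a1 by (simp add: algebra_simps)
  then show "w * a2 = (1 + T) * (N1 * N2 * N3)" by (simp only: w minus_minus)
  have "a5 = m * (T * (N1 * N2 * N3))" unfolding a5 a1 by (simp add: ac_simps)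
  then show "w * a5 = - (T * (N1 * N2 * N3))" by (simp only: w)
  have a3': "a3 = m * (- (N1 * N2 + N2 * N3 + N1 * N3))" unfolding a3 by (simp only: mult_minus_right)
  then show "w * a3 = N1 * N2 + N2 * N3 + N1 * N3" by (simp only: w minus_minus)
  show "w * b2 = K * l1 - N1 * N2 * N3 * al" unfolding b2 w by simp
  have b0: "b0 = m * (N2 * N3 * l4 * T)" unfolding G01(1) f0 by (simp add: ac_simps)
  then show "w * b0 = - (N2 * N3 * l4 * T)" by (simp only: w)
  have "b1 = f1 * l3 - b2 - b0" unfolding G01(2)[symmetric] by simp
  also have "\<dots> = m * (K * l1 - N1 * N2 * N3 * al + N1 * N3 * l3 * (1 - T) - N2 * N3 * l4 * T)"
    unfolding f1 b2 b0 by (simp add: algebra_simps)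
  finally show "w * b1 = - (K * l1) + N1 * N2 * N3 * al + N1 * N3 * l3 * (T - 1) + N2 * N3 * l4 * T"
    by (simp only: w) (simp add: algebra_simps)
  have "a10 = - f0" unfolding H00(1)[symmetric] by simp
  then have a10: "a10 = m * (- (N2 * N3 * T))" unfolding f0 by (simp add: ac_simps)
  then show "w * a10 = N2 * N3 * T" by (simp only: w minus_minus)
  have "a9 = - f1 - a3 - a10" unfolding H00(2)[symmetric] by simp
  also have "\<dots> = m * (N1 * N2 + N2 * N3 + (N1 + N2) * N3 * T)"
    unfolding f1 a3 a10 by (simp add: algebra_simps)
  finally show "w * a9 = - (N1 * N2 + N2 * N3 + (N1 + N2) * N3 * T)" by (simp only: w)
qed

theorem theorem4p1:
  fixes n1 n2 n3 n4 \<alpha>0 \<alpha>1 \<alpha>2 \<alpha>3 \<alpha>4 \<kappa> \<delta> :: complex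
    and a :: "nat \<Rightarrow> ratfun"
    and f0 f1 f2 f3 :: ratfun
    and D :: "ratfun_xy \<Rightarrow> ratfun_xy"
  assumes n: "n1 \<noteq> 0" "n2 \<noteq> 0" "n3 \<noteq> 0" "n4 \<noteq> 0"
    and system: "is_system_S \<alpha>2 a D"
    and scheme: "has_painleve_scheme D
      [(finite_coords 0,    scheme_matrix f0 n1 \<alpha>4),
       (finite_coords 1,    scheme_matrix f1 n2 \<alpha>3),
       (finite_coords \<t>,    scheme_matrix f2 n3 \<alpha>0),
       (infinity_coords \<alpha>2, scheme_matrix f3 n4 \<alpha>1)]"
    and \<kappa>: "\<kappa> = 2 * n1 * n2 * n3 - n1 * n2 - n1 * n3 - n2 * n3"
    and \<delta>: "\<delta> = n1 * n2 * \<alpha>0 + \<kappa> * \<alpha>1 - n1 * n2 * n3 * \<alpha>2 + n1 * n3 * \<alpha>3 + n2 * n3 * \<alpha>4"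
  shows
    "(emb (cst \<delta> * \<t> * (\<t> - 1)) * D \<x> =
       emb (cst (n1 * n2 * n3)) * \<x> * (\<x> - 1) * (emb \<t> - \<x>) * \<y>
       + emb (cst (\<kappa> * \<alpha>1 - n1 * n2 * n3 * \<alpha>2)) * \<x> ^ 2
       + emb (cst (- \<kappa> * \<alpha>1 + n1 * n2 * n3 * \<alpha>2) + cst (n1 * n3 * \<alpha>3) * (\<t> - 1)
              + cst (n2 * n3 * \<alpha>4) * \<t>) * \<x>
       - emb (cst (n2 * n3 * \<alpha>4) * \<t>)) \<and>
     (emb (cst \<delta> * \<t> * (\<t> - 1)) * D \<y> =
       (emb (cst (n1 * n2 + n2 * n3 + n1 * n3)) * \<x> ^ 2
        - emb (cst (n1 * n2 + n2 * n3) + cst ((n1 + n2) * n3) * \<t>) * \<x>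
        + emb (cst (n2 * n3) * \<t>)) * \<y> ^ 2
       + (- emb (cst (2 * \<kappa> * \<alpha>1
                      + (n1 * n2 * n3 - 2 * n1 * n2 - 2 * n1 * n3 - 2 * n2 * n3) * \<alpha>2)) * \<x>
          + emb (cst (\<kappa> * \<alpha>1)
                 + (cst ((n1 * n2 - n1 - n2) * n3) * \<t> - cst (n1 * n2) - cst (n2 * n3)) * cst \<alpha>2
                 - cst (n1 * n3 * \<alpha>3) * (\<t> - 1) - cst (n2 * n3 * \<alpha>4) * \<t>)) * \<y>
       - emb (cst (\<alpha>2 * (\<kappa> * \<alpha>1 + (n1 * n2 * n3 - n1 * n2 - n1 * n3 - n2 * n3) * \<alpha>2))))"
proof -
  define b2 where "b2 = 1/2 * ((3 * a 1 + 2 * a 3) * cst \<alpha>2 - a 4)"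
  define b1 where "b1 = (a 2 + a 9) * cst \<alpha>2 - a 6"
  define e where "e = 1/2 * (a 1 * cst \<alpha>2 + a 4) * cst \<alpha>2"
  have half: "(2 :: ratfun) * (1/2 * z) = z" for z
    using two_neq_0 by simp
  have a4: "a 4 = (3 * a 1 + 2 * a 3) * cst \<alpha>2 - 2 * b2"
    unfolding b2_def half by simp
  have a6: "a 6 = (a 2 + a 9) * cst \<alpha>2 - b1" by (simp add: b1_def)
  have e: "e = ((2 * a 1 + a 3) * cst \<alpha>2 - b2) * cst \<alpha>2"
  proof -
    have "a 1 * cst \<alpha>2 + a 4 = 2 * ((2 * a 1 + a 3) * cst \<alpha>2 - b2)"
      by (simp add: a4 algebra_simps)
    then show ?thesis using two_neq_0 by (simp add: e_def)
  qed
  have D: "is_time_derivative D" and Dx0: "D \<x> = S_rhs_x \<alpha>2 a" and Dy0: "D \<y> = S_rhs_y \<alpha>2 a"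
    using system by (auto simp: is_system_S_def)
  have Dx: "D \<x> = (emb (a 1) * \<x> ^ 3 + emb (a 2) * \<x> ^ 2 + emb (a 5) * \<x> + emb (a 7)) * \<y>
                  + emb b2 * \<x> ^ 2 + emb b1 * \<x> + emb (a 8)"
    unfolding Dx0 S_rhs_x_def b2_def b1_def by (simp only: distrib_right add.assoc)
  have Dy: "D \<y> = (emb (a 3) * \<x> ^ 2 + emb (a 9) * \<x> + emb (a 10)) * \<y> ^ 2
                  + (emb (a 4) * \<x> + emb (a 6)) * \<y> + emb e"
    unfolding Dy0 S_rhs_y_def e_def by (simp only: distrib_right add.assoc)
  \<comment> \<open>What a scheme entry at a finite point \<open>c\<close> moving with speed \<open>c'\<close> says about the coefficients.\<close>
  have fin: "a 1 * c ^ 3 + a 2 * c ^ 2 + a 5 * c + a 7 = 0 \<and>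
      3 * a 1 * c ^ 2 + 2 * a 2 * c + a 5 = f * cst n \<and>
      b2 * c ^ 2 + b1 * c + a 8 - c' = f * cst \<alpha> \<and>
      - (a 3 * c ^ 2 + a 9 * c + a 10) = f"
    if "linear_approximation D (finite_coords c) (scheme_matrix f n \<alpha>)" "D (emb c) = emb c'"
    for c c' f n \<alpha>
  proof -
    have "1 / \<y> \<noteq> 0" using yvar_neq_0 by simp
    from linear_approximation_scheme_matrixD[OF that(1)[unfolded finite_coords_def]
        alg_indep_finite_coords this local_form_finite[OF D Dx Dy that(2)]]
    show ?thesis by (simp add: bicoeff_def)
  qed
  have lin: "linear_approximation D (finite_coords 0) (scheme_matrix f0 n1 \<alpha>4)"
    "linear_approximation D (finite_coords 1) (scheme_matrix f1 n2 \<alpha>3)"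
    "linear_approximation D (finite_coords \<t>) (scheme_matrix f2 n3 \<alpha>0)"
    "linear_approximation D (infinity_coords \<alpha>2) (scheme_matrix f3 n4 \<alpha>1)"
    using scheme by (simp_all add: has_painleve_scheme_def)
  note rules = time_derivative_rules[OF D]
  have Dc: "D (emb 0) = emb 0" "D (emb 1) = emb 0" "D (emb \<t>) = emb 1"
    using rules(3)[of 0] rules(3)[of 1] rules(4) by simp_all
  define X1 where "X1 = 1 / \<x>"
  define Y1 where "Y1 = 1 / (- (\<x> * \<y> + emb (cst \<alpha>2)) * \<x>)"
  have coords: "infinity_coords \<alpha>2 = (X1, Y1)"
    by (simp add: infinity_coords_def Let_def X1_def Y1_def)
  have "alg_indep X1 Y1" "Y1 \<noteq> 0"
    using alg_indep_infinity_coords[of "cst \<alpha>2"] by (simp_all add: X1_def Y1_def)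
  from linear_approximation_scheme_matrixD[OF lin(4)[unfolded coords] this
      local_form_infinity[OF D Dx Dy refl a4 a6 e, unfolded coords]]
  have inf: "cst \<alpha>2 * a 1 - b2 = f3 * cst \<alpha>1" "2 * a 1 + a 3 = f3"
    by (simp_all add: bicoeff_def)
  define w where "w = cst \<delta> * \<t> * (\<t> - 1)"
  have \<kappa>': "cst \<kappa> = 2 * cst n1 * cst n2 * cst n3 - cst n1 * cst n2 - cst n1 * cst n3 - cst n2 * cst n3"
    by (simp add: \<kappa> cst_hom)
  have \<delta>': "cst \<delta> = cst n1 * cst n2 * cst \<alpha>0 + cst \<kappa> * cst \<alpha>1 - cst n1 * cst n2 * cst n3 * cst \<alpha>2
      + cst n1 * cst n3 * cst \<alpha>3 + cst n2 * cst n3 * cst \<alpha>4"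
    by (simp only: \<delta> cst_hom)
  have nz: "cst n1 \<noteq> 0" "cst n2 \<noteq> 0" "cst n3 \<noteq> 0" using n by simp_all
  have at0: "a 7 = 0" "a 5 = f0 * cst n1" "a 8 = f0 * cst \<alpha>4" "- a 10 = f0"
    using fin[OF lin(1) Dc(1)] by simp_all
  have at1: "a 1 + a 2 + a 5 + a 7 = 0" "3 * a 1 + 2 * a 2 + a 5 = f1 * cst n2"
    "b2 + b1 + a 8 = f1 * cst \<alpha>3" "- (a 3 + a 9 + a 10) = f1"
    using fin[OF lin(2) Dc(2)] by simp_all
  have att: "a 1 * \<t> ^ 3 + a 2 * \<t> ^ 2 + a 5 * \<t> + a 7 = 0"
    "3 * a 1 * \<t> ^ 2 + 2 * a 2 * \<t> + a 5 = f2 * cst n3"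
    "b2 * \<t> ^ 2 + b1 * \<t> + a 8 - 1 = f2 * cst \<alpha>0" "- (a 3 * \<t> ^ 2 + a 9 * \<t> + a 10) = f2"
    using fin[OF lin(3) Dc(3)] by simp_all
  note co = coefficients_determined[OF nz tvar_neq at0(1) at1(1) att(1) at0(2) at1(2) att(2)
      at0(3) at1(3) att(3) at0(4) at1(4) att(4) inf \<kappa>' \<delta>' w_def]
  have wa7: "w * a 7 = 0" using at0(1) by simp
  have wa4: "w * a 4 = - ((2 * cst \<kappa> * cst \<alpha>1 + (cst n1 * cst n2 * cst n3 - 2 * cst n1 * cst n2
      - 2 * cst n1 * cst n3 - 2 * cst n2 * cst n3) * cst \<alpha>2))"
  proof -
    have "w * a 4 = (3 * (w * a 1) + 2 * (w * a 3)) * cst \<alpha>2 - 2 * (w * b2)"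
      by (simp add: a4 algebra_simps)
    then show ?thesis unfolding co by (simp add: algebra_simps)
  qed
  have wa6: "w * a 6 = cst \<kappa> * cst \<alpha>1
      + ((cst n1 * cst n2 - cst n1 - cst n2) * cst n3 * \<t> - cst n1 * cst n2 - cst n2 * cst n3) * cst \<alpha>2
      - cst n1 * cst n3 * cst \<alpha>3 * (\<t> - 1) - cst n2 * cst n3 * cst \<alpha>4 * \<t>"
  proof -
    have "w * a 6 = (w * a 2 + w * a 9) * cst \<alpha>2 - w * b1"
      by (simp add: a6 algebra_simps)
    then show ?thesis unfolding co by (simp add: algebra_simps)
  qed
  have we: "w * e = - (cst \<alpha>2 * (cst \<kappa> * cst \<alpha>1 + (cst n1 * cst n2 * cst n3 - cst n1 * cst n2
      - cst n1 * cst n3 - cst n2 * cst n3) * cst \<alpha>2))"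
  proof -
    have "w * e = ((2 * (w * a 1) + w * a 3) * cst \<alpha>2 - w * b2) * cst \<alpha>2"
      by (simp add: e algebra_simps)
    then show ?thesis unfolding co by (simp add: algebra_simps)
  qed
  have "emb w * D \<x> = (emb (w * a 1) * \<x> ^ 3 + emb (w * a 2) * \<x> ^ 2 + emb (w * a 5) * \<x>
      + emb (w * a 7)) * \<y> + emb (w * b2) * \<x> ^ 2 + emb (w * b1) * \<x> + emb (w * a 8)"
    unfolding Dx by (simp add: emb_mult algebra_simps)
  moreover have "emb w * D \<y> = (emb (w * a 3) * \<x> ^ 2 + emb (w * a 9) * \<x> + emb (w * a 10)) * \<y> ^ 2
      + (emb (w * a 4) * \<x> + emb (w * a 6)) * \<y> + emb (w * e)"
    unfolding Dy by (simp add: emb_mult algebra_simps)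
  ultimately show ?thesis
    unfolding w_def[symmetric] co wa4 wa6 wa7 we
    by (simp add: cst_hom emb_hom algebra_simps power2_eq_square power3_eq_cube)
qed

end
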